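(* Let $(\boldsymbol{\chi}^\star,\boldsymbol{\lambda}^\star,\boldsymbol{\mu}^\star)$ be a tuple of optimal primal and dual variables of the quadratic program (P2) described in the context, and suppose that Assumptions 1 and 2 of the context hold, so that the matrix $\mathbf{\Gamma}$ of the context is invertible. Let $\ell$ be a scalar real-valued function of the minimizer, differentiable at $\boldsymbol{\chi}^\star$, which depends on the parameter matrix $\mathbf{W}$ only through the minimizer $\boldsymbol{\chi}^\star=\boldsymbol{\chi}^\star(\mathbf{W})$ of (P2), all the other data of (P2) being held fixed. Let $\nabla_{\boldsymbol{\chi}^\star}\ell$ be its gradient, written as a row vector. Define $$\boldsymbol{\phi}^\top:=-\begin{bmatrix}\nabla_{\boldsymbol{\chi}^\star}\ell & \mathbf{0}^\top & \mathbf{0}^\top\end{bmatrix}\mathbf{\Gamma}^{-1},$$ and partition $\boldsymbol{\phi}^\top=[\boldsymbol{\phi}_{\boldsymbol{\chi}}^\top~~\boldsymbol{\phi}_{\boldsymbol{\lambda}}^\top~~\boldsymbol{\phi}_{\boldsymbol{\mu}}^\top]$ so that $\boldsymbol{\phi}_{\boldsymbol{\chi}},\boldsymbol{\phi}_{\boldsymbol{\lambda}},\boldsymbol{\phi}_{\boldsymbol{\mu}}$ have the dimensions of $\boldsymbol{\chi},\boldsymbol{\lambda},\boldsymbol{\mu}$, respectively. Then $$\nabla_{\mathbf{W}}\ell=\boldsymbol{\lambda}^\star\boldsymbol{\phi}_{\boldsymbol{\chi}}^\top+\boldsymbol{\phi}_{\boldsymbol{\lambda}}(\boldsymbol{\chi}^\star)^\top,$$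 where $\nabla_{\mathbf{W}}\ell$ is the matrix of the same size as $\mathbf{W}$ whose $(i,j)$-th entry is the partial derivative $\nabla_{W_{ij}}\ell=\partial \ell(\boldsymbol{\chi}^\star(\mathbf{W}))/\partial W_{ij}$.
   Context: All vectors are real column vectors, all matrices are real, and inequalities between vectors are entrywise. $\mathbf{e}_n$ is the $n$-th canonical basis vector, and $\mathrm{dg}(\mathbf{x})$ is the diagonal matrix with main diagonal $\mathbf{x}$. Gradients use the numerator layout: $(\nabla_{\mathbf{x}}\mathbf{y})_{ij}=\partial y_i/\partial x_j$, so the gradient of a scalar with respect to a vector is a row vector. The quadratic program (P2). Given a symmetric positive definite matrix $\mathbf{P}$, matrices $\mathbf{W},\mathbf{R},\mathbf{S},\mathbf{T}$ and vectors $\mathbf{d},\mathbf{u}$ of compatible dimensions, (P2) is $$\boldsymbol{\chi}^\star=\arg\min_{\boldsymbol{\chi}}~\boldsymbol{\chi}^\top\mathbf{P}\boldsymbol{\chi}\quad\text{subject to}\quad \mathbf{W}\boldsymbol{\chi}+\mathbf{u}=\mathbf{R}\mathbf{d},\qquad \mathbf{S}\boldsymbol{\chi}+\mathbf{T}\mathbf{d}\leq\mathbf{u}.$$ The vectors $\boldsymbol{\lambda}$ and $\boldsymbol{\mu}\ge\mathbf{0}$ are the Lagrange multipliers of the equality and inequality constraints, respectively, and the Lagrangian is $$L(\boldsymbol{\chi},\boldsymbol{\lambda},\boldsymbol{\mu})=\boldsymbol{\chi}^\top\mathbf{P}\boldsymbol{\chi}+\boldsymbol{\lambda}^\top(\mathbf{W}\boldsymbol{\chi}+\mathbf{u}-\mathbf{R}\mathbf{d})+\boldsymbol{\mu}^\top(\mathbf{S}\boldsymbol{\chi}+\mathbf{T}\mathbf{d}-\mathbf{u}).$$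 Optimal primal/dual variables are tuples satisfying the Karush–Kuhn–Tucker conditions of (P2). Assumption 1. For the given tuple $(\boldsymbol{\chi}^\star,\boldsymbol{\lambda}^\star,\boldsymbol{\mu}^\star)$ of optimal primal/dual variables, the $n$-th inequality constraint is active, i.e., $\mathbf{e}_n^\top(\mathbf{S}\boldsymbol{\chi}^\star+\mathbf{T}\mathbf{d}-\mathbf{u})=0$, if and only if $\mu^\star_n>0$. Let $\mathcal{A}$ be the set of indices of active inequality constraints. The rows of $\mathbf{W}$ together with the vectors $\{\mathbf{e}_n^\top\mathbf{S}\}_{n\in\mathcal{A}}$ are linearly independent. Assumption 2. With $\mathcal{Z}:=\{\mathbf{z}:\mathbf{W}\mathbf{z}=\mathbf{0},~\mathbf{e}_n^\top\mathbf{S}\mathbf{z}=0~\forall n\in\mathcal{A}\}$, it holds that $\mathbf{z}^\top\nabla^2_{\boldsymbol{\chi}\boldsymbol{\chi}}L\,\mathbf{z}>0$ for all $\mathbf{z}\in\mathcal{Z}\setminus\{\mathbf{0}\}$. The matrix $\mathbf{\Gamma}$ is $$\mathbf{\Gamma}:=\begin{bmatrix}2\mathbf{P} & \mathbf{W}^\top & \mathbf{S}^\top\\ \mathbf{W} & \mathbf{0} & \mathbf{0}\\ \mathrm{dg}(\boldsymbol{\mu}^\star)\mathbf{S} & \mathbf{0} & \mathrm{dg}(\mathbf{S}\boldsymbol{\chi}^\star+\mathbf{T}\mathbf{d}-\mathbf{u})\end{bmatrix}.$$ Under Assumptions 1 and 2, $\mathbf{\Gamma}$ is invertible, and the minimizer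 of (P2) is a well-defined differentiable function of $\mathbf{W}$ near the given $\mathbf{W}$. *)

theory Defs
  imports "HOL-Analysis.Analysis"
begin

text \<open>Partial derivatives along a basis vector \<open>b\<close>; for matrices the basis vector belonging
  to the entry \<open>(i, j)\<close> is \<open>axis i (axis j 1)\<close>.\<close>

definition has_partial_deriv :: "('a::euclidean_space \<Rightarrow> real) \<Rightarrow> real \<Rightarrow> 'a \<Rightarrow> 'a \<Rightarrow> bool" where
  "has_partial_deriv f D b x \<longleftrightarrow> ((\<lambda>t. f (x + t *\<^sub>R b)) has_real_derivative D) (at 0)"

definition partial_deriv :: "('a::euclidean_space \<Rightarrow> real) \<Rightarrow> 'a \<Rightarrow> 'a \<Rightarrow> real" where
  "partial_deriv f b x = deriv (\<lambda>t. f (x + t *\<^sub>R b)) 0"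

definition gradient :: "(real^'n \<Rightarrow> real) \<Rightarrow> real^'n \<Rightarrow> real^'n" where
  "gradient f x = (\<chi> i. partial_deriv f (axis i 1) x)"

definition hessian :: "(real^'n \<Rightarrow> real) \<Rightarrow> real^'n \<Rightarrow> real^'n^'n" where
  "hessian f x = (\<chi> i j. partial_deriv (\<lambda>y. partial_deriv f (axis j 1) y) (axis i 1) x)"

definition has_matrix_gradient ::
    "(real^'n^'m \<Rightarrow> real) \<Rightarrow> real^'n^'m \<Rightarrow> real^'n^'m \<Rightarrow> bool" where
  "has_matrix_gradient f G W \<longleftrightarrow> (\<forall>i j. has_partial_deriv f (G $ i $ j) (axis i (axis j 1)) W)"

definition sym_pos_def :: "real^'n^'n \<Rightarrow> bool" where
  "sym_pos_def P \<longleftrightarrow> transpose P = P \<and> (\<forall>x. x \<noteq> 0 \<longrightarrow> x \<bullet> (P *v x) > 0)"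

definition diag_mat :: "real^'n \<Rightarrow> real^'n^'n" where
  "diag_mat v = (\<chi> i j. if i = j then v $ i else 0)"

definition outer_product :: "real^'m \<Rightarrow> real^'n \<Rightarrow> real^'n^'m" where
  "outer_product v w = (\<chi> i j. v $ i * w $ j)"

text \<open>Independence of a family: unlike independence of its image, this excludes repetitions.\<close>

definition independent_family :: "('i \<Rightarrow> 'a::real_vector) \<Rightarrow> 'i set \<Rightarrow> bool" where
  "independent_family f I \<longleftrightarrow> inj_on f I \<and> independent (f ` I)"

text \<open>The vector \<open>u\<close> occurs in both constraints, so that there are as many equality constraints
  as inequality constraints.\<close>

definition qp_objective :: "real^'n^'n \<Rightarrow> real^'n \<Rightarrow> real" where
  "qp_objective P x = x \<bullet> (P *v x)"

definition qp_feasible ::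
    "real^'n^'m \<Rightarrow> real^'p^'m \<Rightarrow> real^'n^'m \<Rightarrow> real^'p^'m \<Rightarrow> real^'p \<Rightarrow> real^'m \<Rightarrow> real^'n \<Rightarrow> bool" where
  "qp_feasible W R S T d u x \<longleftrightarrow> W *v x + u = R *v d \<and> S *v x + T *v d \<le> u"

definition is_qp_minimizer ::
    "real^'n^'n \<Rightarrow> real^'n^'m \<Rightarrow> real^'p^'m \<Rightarrow> real^'n^'m \<Rightarrow> real^'p^'m \<Rightarrow> real^'p \<Rightarrow> real^'m
      \<Rightarrow> real^'n \<Rightarrow> bool" where
  "is_qp_minimizer P W R S T d u x \<longleftrightarrow> is_arg_min (qp_objective P) (qp_feasible W R S T d u) x"

definition qp_minimizer ::
    "real^'n^'n \<Rightarrow> real^'n^'m \<Rightarrow> real^'p^'m \<Rightarrow> real^'n^'m \<Rightarrow> real^'p^'m \<Rightarrow> real^'p \<Rightarrow> real^'m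
      \<Rightarrow> real^'n" where
  "qp_minimizer P W R S T d u = arg_min (qp_objective P) (qp_feasible W R S T d u)"

definition lagrangian ::
    "real^'n^'n \<Rightarrow> real^'n^'m \<Rightarrow> real^'p^'m \<Rightarrow> real^'n^'m \<Rightarrow> real^'p^'m \<Rightarrow> real^'p \<Rightarrow> real^'m
      \<Rightarrow> real^'n \<Rightarrow> real^'m \<Rightarrow> real^'m \<Rightarrow> real" where
  "lagrangian P W R S T d u x lam mu =
     x \<bullet> (P *v x) + lam \<bullet> (W *v x + u - R *v d) + mu \<bullet> (S *v x + T *v d - u)"

definition kkt ::
    "real^'n^'n \<Rightarrow> real^'n^'m \<Rightarrow> real^'p^'m \<Rightarrow> real^'n^'m \<Rightarrow> real^'p^'m \<Rightarrow> real^'p \<Rightarrow> real^'m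
      \<Rightarrow> real^'n \<Rightarrow> real^'m \<Rightarrow> real^'m \<Rightarrow> bool" where
  "kkt P W R S T d u x lam mu \<longleftrightarrow>
     gradient (\<lambda>y. lagrangian P W R S T d u y lam mu) x = 0 \<and>
     qp_feasible W R S T d u x \<and>
     0 \<le> mu \<and>
     (\<forall>n. mu $ n * (S *v x + T *v d - u) $ n = 0)"

definition active_set ::
    "real^'n^'m \<Rightarrow> real^'p^'m \<Rightarrow> real^'p \<Rightarrow> real^'m \<Rightarrow> real^'n \<Rightarrow> 'm set" where
  "active_set S T d u x = {n. (S *v x + T *v d - u) $ n = 0}"

definition strict_complementarity ::
    "real^'n^'m \<Rightarrow> real^'p^'m \<Rightarrow> real^'p \<Rightarrow> real^'m \<Rightarrow> real^'n \<Rightarrow> real^'m \<Rightarrow> bool" where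
  "strict_complementarity S T d u x mu \<longleftrightarrow> (\<forall>n. n \<in> active_set S T d u x \<longleftrightarrow> mu $ n > 0)"

definition licq ::
    "real^'n^'m \<Rightarrow> real^'n^'m \<Rightarrow> real^'p^'m \<Rightarrow> real^'p \<Rightarrow> real^'m \<Rightarrow> real^'n \<Rightarrow> bool" where
  "licq W S T d u x \<longleftrightarrow>
     independent_family (case_sum (\<lambda>i. row i W) (\<lambda>n. row n S)) (UNIV <+> active_set S T d u x)"

definition second_order_condition ::
    "real^'n^'n \<Rightarrow> real^'n^'m \<Rightarrow> real^'p^'m \<Rightarrow> real^'n^'m \<Rightarrow> real^'p^'m \<Rightarrow> real^'p \<Rightarrow> real^'m
      \<Rightarrow> real^'n \<Rightarrow> real^'m \<Rightarrow> real^'m \<Rightarrow> bool" where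
  "second_order_condition P W R S T d u x lam mu \<longleftrightarrow>
     (\<forall>z. W *v z = 0 \<longrightarrow> (\<forall>n \<in> active_set S T d u x. (S *v z) $ n = 0) \<longrightarrow> z \<noteq> 0 \<longrightarrow>
        z \<bullet> (hessian (\<lambda>y. lagrangian P W R S T d u y lam mu) x *v z) > 0)"

text \<open>Block vectors and matrices are indexed by \<open>'n + ('m + 'm)\<close>, following the order
  of the primal variable, the equality multiplier and the inequality multiplier.\<close>

definition block_vec :: "real^'n \<Rightarrow> real^'m \<Rightarrow> real^'k \<Rightarrow> real^('n + ('m + 'k))" where
  "block_vec a b c =
     (\<chi> r. case r of Inl i \<Rightarrow> a $ i | Inr (Inl i) \<Rightarrow> b $ i | Inr (Inr i) \<Rightarrow> c $ i)"

definition block_mat ::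
    "real^'n^'n \<Rightarrow> real^'m^'n \<Rightarrow> real^'k^'n \<Rightarrow>
     real^'n^'m \<Rightarrow> real^'m^'m \<Rightarrow> real^'k^'m \<Rightarrow>
     real^'n^'k \<Rightarrow> real^'m^'k \<Rightarrow> real^'k^'k \<Rightarrow> real^('n + ('m + 'k))^('n + ('m + 'k))" where
  "block_mat A B C D E F G H J =
     (\<chi> r. case r of
        Inl i \<Rightarrow> block_vec (A $ i) (B $ i) (C $ i)
      | Inr (Inl i) \<Rightarrow> block_vec (D $ i) (E $ i) (F $ i)
      | Inr (Inr i) \<Rightarrow> block_vec (G $ i) (H $ i) (J $ i))"

definition Gamma_mat ::
    "real^'n^'n \<Rightarrow> real^'n^'m \<Rightarrow> real^'n^'m \<Rightarrow> real^'p^'m \<Rightarrow> real^'p \<Rightarrow> real^'m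
      \<Rightarrow> real^'n \<Rightarrow> real^'m \<Rightarrow> real^('n + ('m + 'm))^('n + ('m + 'm))" where
  "Gamma_mat P W S T d u x mu = block_mat
     (2 *\<^sub>R P)         (transpose W) (transpose S)
     W                  0             0
     (diag_mat mu ** S) 0             (diag_mat (S *v x + T *v d - u))"

end

theory Submission
  imports Defs
begin

text \<open>
  The minimizer is the primal block of the solution of a \<^emph>\<open>linear\<close> system whose matrix at \<open>W\<close> is
  \<open>\<Gamma>\<close>. Near \<open>W\<close> the active set does not change, so the KKT conditions amount to stationarity,
  the equality constraints, \<open>(S x + T d - u)\<^sub>n = 0\<close> for the active \<open>n\<close> and \<open>\<mu>\<^sub>n = 0\<close> for
  the inactive \<open>n\<close>. By strict complementarity the last two groups may be multiplied by the positive
  number \<open>\<mu>\<^sub>n\<^sup>\<star>\<close> and by the negative slack of \<open>x\<^sup>\<star>\<close>, respectively; both are constants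
  taken from the reference point. The result is \<open>G(W') z = q\<close> with \<open>z = (x, \<lambda>, \<mu>)\<close>, a right-hand
  side \<open>q\<close> independent of \<open>W'\<close>, a matrix \<open>G(W')\<close> affine in \<open>W'\<close>, and \<open>G(W) = \<Gamma>\<close>.

  The matrix \<open>\<Gamma>\<close> is invertible because \<open>P\<close> is positive definite and the active constraint gradients
  are independent (\<open>invertible_kkt_mat\<close>). Hence \<open>z(W') = G(W')\<inverse> q\<close> is defined and continuous near
  \<open>W\<close>. By continuity it keeps the strict signs of the multipliers and slacks, so it is a KKT point of
  the program for \<open>W'\<close> (\<open>linear_system_solution_kkt\<close>), and the KKT point of a strictly convex program
  is its unique minimizer (\<open>kkt_unique_minimizer\<close>).

  In the direction of a matrix \<open>E\<close> the matrix \<open>G\<close> changes by \<open>t N\<close>, where \<open>N z = (E\<^sup>T \<lambda>, E x, 0)\<close>,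
  so the derivative of \<open>z\<close> is \<open>- \<Gamma>\<inverse> N z\<close> (\<open>has_vector_derivative_matrix_inv_mult\<close>). The derivative
  of the loss is therefore \<open>- [\<nabla>\<ell> 0 0] \<Gamma>\<inverse> N z = \<phi> \<bullet> N z = \<phi>\<^sub>x \<bullet> (E\<^sup>T \<lambda>) + \<phi>\<^sub>\<lambda> \<bullet> (E x)\<close>; for the
  matrix unit \<open>E\<close> at \<open>(i, j)\<close> this is \<open>\<lambda>\<^sub>i (\<phi>\<^sub>x)\<^sub>j + (\<phi>\<^sub>\<lambda>)\<^sub>i x\<^sub>j\<close>.
\<close>

section \<open>Linear systems whose matrix varies\<close>

lemma matrix_inv_mult:
  fixes A :: "real^'n^'n"
  assumes "invertible A"
  shows "A ** matrix_inv A = mat 1" and "matrix_inv A ** A = mat 1"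
proof -
  have "A ** matrix_inv A = mat 1 \<and> matrix_inv A ** A = mat 1"
    unfolding matrix_inv_def by (rule someI_ex) (use assms in \<open>simp add: invertible_def\<close>)
  then show "A ** matrix_inv A = mat 1" and "matrix_inv A ** A = mat 1" by auto
qed

lemma solution_eq_matrix_inv:
  fixes A :: "real^'n^'n"
  assumes "invertible A"
  shows "A *v z = q \<longleftrightarrow> z = matrix_inv A *v q"
  by (metis assms matrix_inv_mult matrix_vector_mul_assoc matrix_vector_mul_lid)

lemma tendsto_det:
  fixes A :: "'a \<Rightarrow> real^'n^'n"
  assumes "(A \<longlongrightarrow> A0) F"
  shows "((\<lambda>w. det (A w)) \<longlongrightarrow> det A0) F"
  unfolding det_def by (intro tendsto_intros assms)

lemma eventually_invertible:
  fixes A :: "'a \<Rightarrow> real^'n^'n"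
  assumes "(A \<longlongrightarrow> A0) F" and "invertible A0"
  shows "\<forall>\<^sub>F w in F. invertible (A w)"
  using tendsto_imp_eventually_ne[OF tendsto_det[OF assms(1)], of 0] assms(2)
  by (simp add: invertible_det_nz)

text \<open>By Cramer's rule each component of the solution is a quotient of two determinants, hence a
  rational function of the entries of the matrix.\<close>

lemma tendsto_matrix_inv_mult:
  fixes A :: "'a \<Rightarrow> real^'n^'n"
  assumes A: "(A \<longlongrightarrow> A0) F" and inv: "invertible A0"
  shows "((\<lambda>w. matrix_inv (A w) *v q) \<longlongrightarrow> matrix_inv A0 *v q) F"
proof -
  define cram where
    "cram M = (\<chi> k. det (\<chi> i j. if j = k then q $ i else M $ i $ j) / det M)" for M :: "real^'n^'n"
  have cram: "matrix_inv M *v q = cram M" if "invertible M" for M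
    using cramer[of M "matrix_inv M *v q" q] solution_eq_matrix_inv[OF that] that
    unfolding cram_def by (simp add: invertible_det_nz)
  have "((\<lambda>w. cram (A w)) \<longlongrightarrow> cram A0) F"
    unfolding cram_def
  proof (rule vec_tendstoI, simp only: vec_lambda_beta, rule tendsto_divide)
    fix k
    have "((\<lambda>w. \<chi> i j. if j = k then q $ i else A w $ i $ j)
        \<longlongrightarrow> (\<chi> i j. if j = k then q $ i else A0 $ i $ j)) F"
      by (rule vec_tendstoI, simp, rule vec_tendstoI) (auto intro!: tendsto_intros A)
    then show "((\<lambda>w. det (\<chi> i j. if j = k then q $ i else A w $ i $ j))
        \<longlongrightarrow> det (\<chi> i j. if j = k then q $ i else A0 $ i $ j)) F"
      by (rule tendsto_det)
    show "((\<lambda>w. det (A w)) \<longlongrightarrow> det A0) F" by (rule tendsto_det[OF A])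
    show "det A0 \<noteq> 0" using inv by (simp add: invertible_det_nz)
  qed
  moreover have "\<forall>\<^sub>F w in F. cram (A w) = matrix_inv (A w) *v q"
    using eventually_invertible[OF assms] by eventually_elim (simp add: cram)
  ultimately show ?thesis
    unfolding cram[OF inv] by (rule Lim_transform_eventually)
qed

text \<open>Subtracting the systems solved by \<open>z t\<close> and \<open>z 0\<close> gives \<open>A (z t - z 0) = - t N (z t)\<close>, so
  continuity of \<open>z\<close> at \<open>0\<close> already determines its derivative there.\<close>

lemma has_vector_derivative_matrix_inv_mult:
  fixes A N :: "real^'n^'n"
  assumes inv: "invertible A"
  shows "((\<lambda>t. matrix_inv (A + t *\<^sub>R N) *v q) has_vector_derivative
           - (matrix_inv A *v (N *v (matrix_inv A *v q)))) (at 0)"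
proof -
  define z where "z t = matrix_inv (A + t *\<^sub>R N) *v q" for t
  define D where "D = - (matrix_inv A *v (N *v z 0))"
  have A: "((\<lambda>t. A + t *\<^sub>R N) \<longlongrightarrow> A) (at 0)"
    by (auto intro!: tendsto_eq_intros)
  have z: "(z \<longlongrightarrow> z 0) (at 0)"
    using tendsto_matrix_inv_mult[OF A inv, of q] unfolding z_def by simp
  have quot: "\<forall>\<^sub>F t in at 0. norm (- (matrix_inv A *v (N *v z t)) - D)
                = norm (z (0 + t) - z 0 - t *\<^sub>R D) / norm t"
    using eventually_invertible[OF A inv] eventually_neq_at_within[of 0]
  proof eventually_elim
    case (elim t)
    have zt: "(A + t *\<^sub>R N) *v z t = q"
      using solution_eq_matrix_inv[OF elim(1)] by (simp add: z_def)
    have z0: "A *v z 0 = q"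
      using solution_eq_matrix_inv[OF inv] by (simp add: z_def)
    have "A *v (z t - z 0) = - (t *\<^sub>R (N *v z t))"
      using zt z0 by (simp add: algebra_simps scaleR_matrix_vector_assoc add_eq_0_iff)
    then have "z t - z 0 = matrix_inv A *v (- (t *\<^sub>R (N *v z t)))"
      using solution_eq_matrix_inv[OF inv] by blast
    also have "\<dots> = t *\<^sub>R (- (matrix_inv A *v (N *v z t)))"
      by (metis matrix_vector_mult_scaleR scaleR_minus_left scaleR_minus_right)
    finally have "z (0 + t) - z 0 - t *\<^sub>R D = t *\<^sub>R (- (matrix_inv A *v (N *v z t)) - D)"
      by (simp add: scaleR_diff_right)
    then show ?case using elim(2) by simp
  qed
  have "((\<lambda>t. - (matrix_inv A *v (N *v z t)) - D) \<longlongrightarrow> - (matrix_inv A *v (N *v z 0)) - D) (at 0)"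
    by (intro tendsto_intros bounded_linear.tendsto[OF matrix_vector_mul_bounded_linear] z)
  then have "((\<lambda>t. norm (- (matrix_inv A *v (N *v z t)) - D)) \<longlongrightarrow> 0) (at 0)"
    unfolding D_def by (simp add: tendsto_norm_zero)
  from Lim_transform_eventually[OF this quot]
  have "(z has_vector_derivative D) (at 0)"
    unfolding has_vector_derivative_def has_derivative_at by (simp add: bounded_linear_scaleR_left)
  then show ?thesis unfolding z_def D_def by simp
qed

section \<open>Block vectors and the KKT matrix\<close>

definition primal_part :: "real^('n::finite + ('m::finite + 'k::finite)) \<Rightarrow> real^'n" where
  "primal_part z = (\<chi> i. z $ Inl i)"

definition eq_part :: "real^('n::finite + ('m::finite + 'k::finite)) \<Rightarrow> real^'m" where
  "eq_part z = (\<chi> i. z $ Inr (Inl i))"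

definition ineq_part :: "real^('n::finite + ('m::finite + 'k::finite)) \<Rightarrow> real^'k" where
  "ineq_part z = (\<chi> i. z $ Inr (Inr i))"

lemma block_vec_nth [simp]:
  "block_vec a b c $ Inl i = a $ i"
  "block_vec a b c $ Inr (Inl j) = b $ j"
  "block_vec a b c $ Inr (Inr k) = c $ k"
  by (simp_all add: block_vec_def)

lemma block_parts [simp]:
  "block_vec (primal_part z) (eq_part z) (ineq_part z) = z"
  "primal_part (block_vec a b c) = a"
  "eq_part (block_vec a b c) = b"
  "ineq_part (block_vec a b c) = c"
  by (auto simp: vec_eq_iff block_vec_def primal_part_def eq_part_def ineq_part_def
      split: sum.splits)

lemma block_vec_eq_iff [simp]:
  "block_vec a b c = block_vec a' b' c' \<longleftrightarrow> a = a' \<and> b = b' \<and> c = c'"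
  by (metis block_parts(2-4))

lemma block_vec_0 [simp]: "block_vec 0 0 0 = 0"
  by (auto simp: vec_eq_iff block_vec_def split: sum.splits)

lemma sum_UNIV_Plus:
  fixes f :: "'a::finite + 'b::finite \<Rightarrow> 'c::comm_monoid_add"
  shows "sum f UNIV = (\<Sum>i\<in>UNIV. f (Inl i)) + (\<Sum>j\<in>UNIV. f (Inr j))"
  using sum.Plus[of "UNIV :: 'a set" "UNIV :: 'b set" f] by (simp add: UNIV_Plus_UNIV o_def)

lemma inner_block_vec [simp]:
  "block_vec a b c \<bullet> block_vec a' b' c' = a \<bullet> a' + b \<bullet> b' + c \<bullet> c'"
  by (simp add: inner_vec_def sum_UNIV_Plus)

lemma block_mat_mult_vec:
  "block_mat A B C D E F G H J *v block_vec a b c =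
     block_vec (A *v a + B *v b + C *v c) (D *v a + E *v b + F *v c) (G *v a + H *v b + J *v c)"
  by (auto simp: vec_eq_iff matrix_vector_mult_def block_mat_def sum_UNIV_Plus split: sum.splits)

lemma diag_mat_mult_vec [simp]: "diag_mat v *v w = (\<chi> n. v $ n * w $ n)"
  by (simp add: diag_mat_def matrix_vector_mult_def vec_eq_iff if_distribR if_distrib cong: if_cong)

text \<open>The parameters \<open>mu\<close> and \<open>s\<close> (the slack) of the matrix are separate from the unknowns that it
  acts on: keeping them at their values at the reference point while \<open>W\<close> varies makes the system
  linear.\<close>

definition kkt_mat ::
    "real^'n^'n \<Rightarrow> real^'n^'m \<Rightarrow> real^'m \<Rightarrow> real^'m \<Rightarrow> real^'n^'m
      \<Rightarrow> real^('n + ('m + 'm))^('n + ('m + 'm))" where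
  "kkt_mat P S mu s W =
     block_mat (2 *\<^sub>R P) (transpose W) (transpose S) W 0 0 (diag_mat mu ** S) 0 (diag_mat s)"

text \<open>The derivative of the KKT matrix with respect to \<open>W\<close> in the direction \<open>E\<close>.\<close>

definition kkt_dir :: "real^'n^'m \<Rightarrow> real^('n + ('m + 'm))^('n + ('m + 'm))" where
  "kkt_dir E = block_mat 0 (transpose E) 0 E 0 0 0 0 0"

lemma Gamma_mat_eq_kkt_mat:
  "Gamma_mat P W S T d u x mu = kkt_mat P S mu (S *v x + T *v d - u) W"
  by (simp add: Gamma_mat_def kkt_mat_def)

lemma kkt_mat_mult_vec:
  "kkt_mat P S mu s W *v block_vec a b c =
     block_vec (2 *\<^sub>R (P *v a) + b v* W + c v* S) (W *v a)
       (\<chi> n. mu $ n * (S *v a) $ n + s $ n * c $ n)"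
  unfolding kkt_mat_def block_mat_mult_vec
  by (simp add: vec_eq_iff flip: scaleR_matrix_vector_assoc matrix_vector_mul_assoc
      del: block_vec_nth)
    (simp add: vec_eq_iff block_vec_def split: sum.splits)

lemma kkt_dir_mult_vec: "kkt_dir E *v block_vec a b c = block_vec (b v* E) (E *v a) 0"
  by (simp add: kkt_dir_def block_mat_mult_vec)

lemma kkt_mat_perturb: "kkt_mat P S mu s (W + t *\<^sub>R E) = kkt_mat P S mu s W + t *\<^sub>R kkt_dir E"
  by (auto simp: vec_eq_iff kkt_mat_def kkt_dir_def block_mat_def block_vec_def transpose_def
      split: sum.splits)

lemma tendsto_kkt_mat:
  "((\<lambda>W'. kkt_mat P S mu s W') \<longlongrightarrow> kkt_mat P S mu s W) (nhds W)"
  unfolding kkt_mat_def block_mat_def block_vec_def transpose_def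
  by (intro vec_tendstoI) (auto split: sum.splits intro!: tendsto_intros filterlim_ident)

section \<open>Optimality conditions\<close>

text \<open>The Lagrangian is quadratic in the primal variable, so its gradient is the coefficient of the
  linear term of this exact expansion.\<close>

lemma lagrangian_expand:
  fixes P :: "real^'n^'n" and W S :: "real^'n^'m"
  assumes "transpose P = P"
  shows "lagrangian P W R S T d u (y + t *\<^sub>R b) lam mu = lagrangian P W R S T d u y lam mu
           + t * ((2 *\<^sub>R (P *v y) + lam v* W + mu v* S) \<bullet> b) + t\<^sup>2 * (b \<bullet> (P *v b))"
proof -
  have "b \<bullet> (P *v y) = y \<bullet> (P *v b)"
    by (metis assms dot_lmul_matrix inner_commute transpose_matrix_vector)
  moreover have "(P *v y) \<bullet> b = b \<bullet> (P *v y)" by (simp add: inner_commute)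
  ultimately show ?thesis
    unfolding lagrangian_def
    by (simp add: algebra_simps inner_add_left inner_add_right inner_diff_right dot_lmul_matrix
        power2_eq_square matrix_vector_right_distrib matrix_vector_mult_scaleR)
qed

lemma gradient_lagrangian:
  fixes P :: "real^'n^'n" and W S :: "real^'n^'m"
  assumes "transpose P = P"
  shows "gradient (\<lambda>y. lagrangian P W R S T d u y lam mu) x
           = 2 *\<^sub>R (P *v x) + lam v* W + mu v* S"
proof -
  have "partial_deriv (\<lambda>y. lagrangian P W R S T d u y lam mu) b x
          = (2 *\<^sub>R (P *v x) + lam v* W + mu v* S) \<bullet> b" for b
    unfolding partial_deriv_def lagrangian_expand[OF assms]
    by (rule DERIV_imp_deriv) (auto intro!: derivative_eq_intros)
  then show ?thesis by (simp add: gradient_def vec_eq_iff inner_axis)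
qed

lemma kkt_iff:
  fixes P :: "real^'n^'n" and W S :: "real^'n^'m"
  assumes "sym_pos_def P"
  shows "kkt P W R S T d u x lam mu \<longleftrightarrow>
           2 *\<^sub>R (P *v x) + lam v* W + mu v* S = 0 \<and>
           W *v x = R *v d - u \<and> (\<forall>n. (S *v x + T *v d - u) $ n \<le> 0) \<and>
           (\<forall>n. 0 \<le> mu $ n) \<and> (\<forall>n. mu $ n * (S *v x + T *v d - u) $ n = 0)"
proof -
  have "transpose P = P" using assms by (simp add: sym_pos_def_def)
  then show ?thesis
    unfolding kkt_def qp_feasible_def gradient_lagrangian[OF \<open>transpose P = P\<close>]
    by (auto simp: eq_diff_eq less_eq_vec_def)
qed

text \<open>The KKT conditions are sufficient because the objective is strictly convex: for feasible \<open>y\<close>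
  the first-order term \<open>2 (P x) \<bullet> (y - x)\<close> equals \<open>- \<mu> \<bullet> (S y + T d - u)\<close> by stationarity and
  complementary slackness, and this is nonnegative.\<close>

lemma kkt_strict_minimizer:
  fixes P :: "real^'n^'n" and W S :: "real^'n^'m"
  assumes P: "sym_pos_def P" and kkt: "kkt P W R S T d u x lam mu"
    and y: "qp_feasible W R S T d u y" and ne: "y \<noteq> x"
  shows "qp_objective P x < qp_objective P y"
proof -
  have symP: "transpose P = P" using P by (simp add: sym_pos_def_def)
  have stat: "2 *\<^sub>R (P *v x) + lam v* W + mu v* S = 0"
    and slack: "\<And>n. mu $ n * (S *v x + T *v d - u) $ n = 0"
    using kkt unfolding kkt_iff[OF P] by blast+
  have x: "qp_feasible W R S T d u x" and mu: "0 \<le> mu"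
    using kkt by (simp_all add: kkt_def)
  have "W *v y = W *v x"
    using x y unfolding qp_feasible_def by (metis add_right_cancel)
  then have W: "lam \<bullet> (W *v (y - x)) = 0" by (simp add: matrix_vector_mult_diff_distrib)
  have slackx: "mu \<bullet> (S *v x + T *v d - u) = 0"
    unfolding inner_vec_def by (rule sum.neutral) (use slack in simp)
  have slacky: "mu \<bullet> (S *v y + T *v d - u) \<le> 0"
    unfolding inner_vec_def
  proof (rule sum_nonpos)
    fix n
    have "0 \<le> mu $ n" and "(S *v y + T *v d - u) $ n \<le> 0"
      using mu y by (auto simp: less_eq_vec_def qp_feasible_def)
    then show "mu $ n \<bullet> (S *v y + T *v d - u) $ n \<le> 0"
      by (simp add: mult_nonneg_nonpos)
  qed
  have "mu \<bullet> (S *v (y - x)) = mu \<bullet> (S *v y + T *v d - u) - mu \<bullet> (S *v x + T *v d - u)"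
    by (simp add: algebra_simps inner_diff_right inner_add_right)
  then have S: "mu \<bullet> (S *v (y - x)) \<le> 0" using slackx slacky by simp
  have "(2 *\<^sub>R (P *v x) + lam v* W + mu v* S) \<bullet> (y - x) = 0" by (simp add: stat)
  then have lin: "2 * ((P *v x) \<bullet> (y - x)) \<ge> 0"
    using W S by (simp add: inner_add_left dot_lmul_matrix)
  have "(P *v x) \<bullet> (y - x) = x \<bullet> (P *v (y - x))"
    by (metis symP dot_lmul_matrix transpose_matrix_vector)
  moreover have "(P *v x) \<bullet> (y - x) = (y - x) \<bullet> (P *v x)" by (rule inner_commute)
  ultimately have "qp_objective P y
      = qp_objective P x + 2 * ((P *v x) \<bullet> (y - x)) + (y - x) \<bullet> (P *v (y - x))"
    unfolding qp_objective_def by (simp add: algebra_simps inner_diff_left inner_diff_right)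
  moreover have "(y - x) \<bullet> (P *v (y - x)) > 0"
    using P ne by (simp add: sym_pos_def_def)
  ultimately show ?thesis using lin by linarith
qed

lemma kkt_unique_minimizer:
  fixes P :: "real^'n^'n" and W S :: "real^'n^'m"
  assumes P: "sym_pos_def P" and kkt: "kkt P W R S T d u x lam mu"
  shows "is_qp_minimizer P W R S T d u y \<longleftrightarrow> y = x"
proof -
  have x: "qp_feasible W R S T d u x" using kkt by (simp add: kkt_def)
  show ?thesis
    using x kkt_strict_minimizer[OF assms]
    unfolding is_qp_minimizer_def is_arg_min_linorder by (metis leD less_imp_le order_refl)
qed

lemma kkt_qp_minimizer:
  fixes P :: "real^'n^'n" and W S :: "real^'n^'m"
  assumes "sym_pos_def P" and "kkt P W R S T d u x lam mu"
  shows "qp_minimizer P W R S T d u = x"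
  using kkt_unique_minimizer[OF assms]
  unfolding qp_minimizer_def arg_min_def is_qp_minimizer_def by (intro some_equality) auto

section \<open>Invertibility of the KKT matrix\<close>

lemma independent_family_sum_eq_0:
  fixes f :: "'i \<Rightarrow> 'a::real_vector"
  assumes ind: "independent_family f I" and fin: "finite I"
    and sum: "(\<Sum>i\<in>I. c i *\<^sub>R f i) = 0" and i: "i \<in> I"
  shows "c i = 0"
proof -
  have inj: "inj_on f I" and indep: "independent (f ` I)"
    using ind by (auto simp: independent_family_def)
  have "(\<Sum>v\<in>f ` I. c (inv_into I f v) *\<^sub>R v) = (\<Sum>i\<in>I. c i *\<^sub>R f i)"
    by (simp add: sum.reindex[OF inj] inj)
  then have "c (inv_into I f (f i)) = 0"
    using independentD[OF indep, of "f ` I" "\<lambda>v. c (inv_into I f v)" "f i"] fin sum i by simp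
  then show ?thesis by (simp add: inj i)
qed

lemma vector_matrix_mult_rows:
  fixes A :: "real^'n^'m"
  shows "b v* A = (\<Sum>i\<in>UNIV. b $ i *\<^sub>R row i A)"
  by (simp add: vec_eq_iff vector_matrix_mult_def row_def mult.commute)

lemma licq_multipliers_eq_0:
  fixes W S :: "real^'n^'m"
  assumes licq: "licq W S T d u x"
    and sum: "b v* W + c v* S = 0"
    and supp: "\<And>n. n \<notin> active_set S T d u x \<Longrightarrow> c $ n = 0"
  shows "b = 0" and "c = 0"
proof -
  let ?A = "active_set S T d u x"
  let ?f = "case_sum (\<lambda>i. row i W) (\<lambda>n. row n S)"
  let ?c = "case_sum (\<lambda>i. b $ i) (\<lambda>n. c $ n)"
  have "c v* S = (\<Sum>n\<in>?A. c $ n *\<^sub>R row n S)"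
    unfolding vector_matrix_mult_rows by (rule sum.mono_neutral_right) (auto simp: supp)
  then have "(\<Sum>r\<in>UNIV <+> ?A. ?c r *\<^sub>R ?f r) = 0"
    using sum by (simp add: sum.Plus vector_matrix_mult_rows o_def)
  then have *: "?c r = 0" if "r \<in> UNIV <+> ?A" for r
    using independent_family_sum_eq_0[of ?f "UNIV <+> ?A" ?c r] licq that
    unfolding licq_def by simp
  have "b $ i = 0" for i using *[of "Inl i"] by (simp add: InlI)
  then show "b = 0" by (simp add: vec_eq_iff)
  have "c $ n = 0" for n using *[of "Inr n"] supp[of n] by auto
  then show "c = 0" by (simp add: vec_eq_iff)
qed

text \<open>A kernel vector \<open>(a, b, c)\<close> has \<open>S a\<close> vanishing on the active constraints and \<open>c\<close> vanishing on
  the inactive ones, so \<open>c \<bullet> (S a) = 0\<close>. Testing the first block row with \<open>a\<close> leaves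
  \<open>2 a \<bullet> (P a) = 0\<close>, whence \<open>a = 0\<close>; the remaining relation between the rows of \<open>W\<close> and the active
  rows of \<open>S\<close> is trivial by the linear independence qualification.\<close>

lemma invertible_kkt_mat:
  fixes P :: "real^'n^'n" and W S :: "real^'n^'m"
  assumes P: "sym_pos_def P" and licq: "licq W S T d u x"
    and active: "\<And>n. n \<in> active_set S T d u x \<Longrightarrow> mu $ n \<noteq> 0 \<and> s $ n = 0"
    and inactive: "\<And>n. n \<notin> active_set S T d u x \<Longrightarrow> mu $ n = 0 \<and> s $ n \<noteq> 0"
  shows "invertible (kkt_mat P S mu s W)"
  unfolding invertible_left_inverse matrix_left_invertible_ker
proof (intro allI impI)
  fix z :: "real^('n + ('m + 'm))"
  assume z: "kkt_mat P S mu s W *v z = 0"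
  define a b c where "a = primal_part z" and "b = eq_part z" and "c = ineq_part z"
  have zabc: "z = block_vec a b c" by (simp add: a_def b_def c_def)
  from z have *: "kkt_mat P S mu s W *v block_vec a b c = block_vec 0 0 0"
    unfolding zabc by simp
  have dual: "2 *\<^sub>R (P *v a) + b v* W + c v* S = 0" and Wa: "W *v a = 0"
    and comp: "\<And>n. mu $ n * (S *v a) $ n + s $ n * c $ n = 0"
    using * unfolding kkt_mat_mult_vec block_vec_eq_iff by (simp_all add: vec_eq_iff)
  have Sa: "(S *v a) $ n = 0" if "n \<in> active_set S T d u x" for n
    using comp[of n] active[OF that] by simp
  have c0: "c $ n = 0" if "n \<notin> active_set S T d u x" for n
    using comp[of n] inactive[OF that] by simp
  have "c \<bullet> (S *v a) = 0"
    unfolding inner_vec_def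
  proof (rule sum.neutral, intro ballI)
    fix n show "c $ n \<bullet> (S *v a) $ n = 0"
      by (cases "n \<in> active_set S T d u x") (simp_all add: Sa c0)
  qed
  moreover have "(2 *\<^sub>R (P *v a) + b v* W + c v* S) \<bullet> a = 0" by (simp add: dual)
  ultimately have "a \<bullet> (P *v a) = 0"
    by (simp add: inner_add_left dot_lmul_matrix Wa inner_commute[of "P *v a"])
  then have a: "a = 0" using P unfolding sym_pos_def_def by (metis less_irrefl)
  have "b v* W + c v* S = 0" using dual a by simp
  from licq_multipliers_eq_0[OF licq this c0] show "z = 0"
    by (simp add: zabc a)
qed

section \<open>The gradient formula\<close>

text \<open>The terms of the KKT equations that do not involve the unknowns \<open>(x, \<lambda>, \<mu>)\<close>, the inequality
  rows being scaled by \<open>mu\<close> as in the KKT matrix.\<close>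

definition kkt_rhs :: "real^'p^'m \<Rightarrow> real^'p^'m \<Rightarrow> real^'p \<Rightarrow> real^'m \<Rightarrow> real^'m
      \<Rightarrow> real^('n::finite + ('m::finite + 'm))" where
  "kkt_rhs R T d u mu = block_vec 0 (R *v d - u) (\<chi> n. mu $ n * (u - T *v d) $ n)"

text \<open>The term \<open>s\<^sub>n \<mu>\<^sub>n\<close> of the last block row vanishes at the reference point itself by
  complementary slackness.\<close>

lemma kkt_solves_linear_system:
  fixes P :: "real^'n^'n" and W S :: "real^'n^'m"
  assumes P: "sym_pos_def P" and kkt: "kkt P W R S T d u x lam mu"
  shows "kkt_mat P S mu (S *v x + T *v d - u) W *v block_vec x lam mu = kkt_rhs R T d u mu"
proof -
  have "2 *\<^sub>R (P *v x) + lam v* W + mu v* S = 0" and "W *v x = R *v d - u"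
    and slack: "\<And>n. mu $ n * (S *v x + T *v d - u) $ n = 0"
    using kkt unfolding kkt_iff[OF P] by blast+
  moreover have "mu $ n * (S *v x) $ n + (S *v x + T *v d - u) $ n * mu $ n
      = mu $ n * (u - T *v d) $ n" for n
    using slack[of n] by (simp add: algebra_simps)
  ultimately show ?thesis
    by (simp add: kkt_mat_mult_vec kkt_rhs_def)
qed

text \<open>For \<open>n \<in> A\<close> the last block row says that the slack of \<open>y\<close> vanishes, and otherwise that its
  multiplier does. The two remaining sign conditions are strict inequalities, hence stable under small
  changes of \<open>W\<close>.\<close>

lemma linear_system_solution_kkt:
  fixes P :: "real^'n^'n" and W S :: "real^'n^'m"
  assumes P: "sym_pos_def P"
    and sol: "kkt_mat P S mu s W *v block_vec y b c = kkt_rhs R T d u mu"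
    and active: "\<And>n. n \<in> A \<Longrightarrow> mu $ n \<noteq> 0 \<and> s $ n = 0 \<and> 0 < c $ n"
    and inactive: "\<And>n. n \<notin> A \<Longrightarrow> mu $ n = 0 \<and> s $ n \<noteq> 0 \<and> (S *v y + T *v d - u) $ n < 0"
  shows "kkt P W R S T d u y b c"
proof -
  have dual: "2 *\<^sub>R (P *v y) + b v* W + c v* S = 0" and W: "W *v y = R *v d - u"
    and comp: "\<And>n. mu $ n * (S *v y) $ n + s $ n * c $ n = mu $ n * (u - T *v d) $ n"
    using sol unfolding kkt_mat_mult_vec kkt_rhs_def block_vec_eq_iff
    by (simp_all add: vec_eq_iff)
  have act: "(S *v y + T *v d - u) $ n = 0" if "n \<in> A" for n
    using comp[of n] active[OF that] by simp
  have inact: "c $ n = 0" if "n \<notin> A" for n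
    using comp[of n] inactive[OF that] by simp
  have "(S *v y + T *v d - u) $ n \<le> 0 \<and> 0 \<le> c $ n \<and> c $ n * (S *v y + T *v d - u) $ n = 0" for n
    using act[of n] inact[of n] active[of n] inactive[of n] by (cases "n \<in> A") auto
  then show ?thesis
    using dual W unfolding kkt_iff[OF P] by blast
qed

lemma has_derivative_gradient:
  fixes l :: "real^'n \<Rightarrow> real"
  assumes "l differentiable (at x)"
  shows "(l has_derivative (\<lambda>h. gradient l x \<bullet> h)) (at x)"
proof -
  obtain l' where l': "(l has_derivative l') (at x)"
    using assms by (auto simp: differentiable_def)
  then interpret l': linear l' by (rule has_derivative_linear)
  have "partial_deriv l b x = l' b" for b
  proof -
    have "(l \<circ> (\<lambda>t. x + t *\<^sub>R b) has_derivative l' \<circ> (\<lambda>t. t *\<^sub>R b)) (at 0)"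
      by (rule diff_chain_at) (auto intro!: derivative_eq_intros simp: l')
    then have "((\<lambda>t. l (x + t *\<^sub>R b)) has_real_derivative l' b) (at 0)"
      by (simp add: has_field_derivative_def o_def l'.scaleR mult_commute_abs)
    then show ?thesis unfolding partial_deriv_def by (rule DERIV_imp_deriv)
  qed
  then have "l' h = gradient l x \<bullet> h" for h
    using l'.sum[of "\<lambda>i. h $ i *\<^sub>R axis i 1" UNIV] basis_expansion[of h]
    by (simp add: gradient_def inner_vec_def l'.scaleR mult.commute scalar_mult_eq_scaleR)
  then show ?thesis using l' by (metis (no_types, lifting) ext)
qed

lemma inner_axis_matrix:
  fixes a :: "real^'n" and b :: "real^'m"
  shows "a \<bullet> (b v* axis i (axis j 1)) = a $ j * b $ i"
    and "b \<bullet> (axis i (axis j 1) *v a) = b $ i * a $ j"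
proof -
  have "axis i (axis j 1) *v a = a $ j *\<^sub>R (axis i 1 :: real^'m)"
  proof (rule vec_eq_iff[THEN iffD2], intro allI)
    fix k
    show "(axis i (axis j 1) *v a) $ k = (a $ j *\<^sub>R (axis i 1 :: real^'m)) $ k"
      by (cases "k = i") (simp_all add: matrix_vector_mul_component inner_axis' axis_def[of i])
  qed
  then show "b \<bullet> (axis i (axis j 1) *v a) = b $ i * a $ j"
    by (simp add: inner_axis)
  then show "a \<bullet> (b v* axis i (axis j 1)) = a $ j * b $ i"
    by (simp add: inner_commute[of a] dot_lmul_matrix)
qed

theorem proposition2:
  fixes P :: "real^'n^'n"
    and W S :: "real^'n^'m"
    and R T :: "real^'p^'m"
    and d :: "real^'p"
    and u lam mu phi_lam phi_mu :: "real^'m"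
    and x phi_x :: "real^'n"
    and l :: "real^'n \<Rightarrow> real"
  assumes "sym_pos_def P"
    and "kkt P W R S T d u x lam mu"
    and "strict_complementarity S T d u x mu"
    and "licq W S T d u x"
    and "second_order_condition P W R S T d u x lam mu"
    and "l differentiable (at x)"
    and "block_vec phi_x phi_lam phi_mu =
           - (block_vec (gradient l x) 0 0 v* matrix_inv (Gamma_mat P W S T d u x mu))"
  shows "invertible (Gamma_mat P W S T d u x mu)
    \<and> (\<forall>\<^sub>F W' in nhds W. \<exists>!y. is_qp_minimizer P W' R S T d u y)
    \<and> qp_minimizer P W R S T d u = x
    \<and> has_matrix_gradient (\<lambda>W'. l (qp_minimizer P W' R S T d u))
         (outer_product lam phi_x + outer_product phi_lam x) W"
proof -
  define s where "s = S *v x + T *v d - u"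
  define A where "A = active_set S T d u x"
  define G where "G = kkt_mat P S mu s"
  define q :: "real^('n + ('m + 'm))" where "q = kkt_rhs R T d u mu"
  define z where "z W' = matrix_inv (G W') *v q" for W'
  have Gamma: "Gamma_mat P W S T d u x mu = G W"
    by (simp add: G_def s_def Gamma_mat_eq_kkt_mat)
  have active: "0 < mu $ n \<and> s $ n = 0" if "n \<in> A" for n
    using assms(3) that
    by (auto simp: A_def s_def active_set_def strict_complementarity_def)
  have inactive: "mu $ n = 0 \<and> s $ n < 0" if "n \<notin> A" for n
  proof -
    have "0 \<le> mu $ n" and "s $ n \<le> 0"
      using assms(2) by (auto simp: kkt_def qp_feasible_def less_eq_vec_def s_def)
    moreover have "\<not> 0 < mu $ n" and "s $ n \<noteq> 0"
      using assms(3) that by (auto simp: A_def s_def active_set_def strict_complementarity_def)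
    ultimately show ?thesis by auto
  qed
  have inv: "invertible (G W)"
    unfolding G_def using assms(1,4)
    by (rule invertible_kkt_mat) (use active inactive in \<open>force simp: A_def\<close>)+
  have G: "(G \<longlongrightarrow> G W) (nhds W)"
    unfolding G_def by (rule tendsto_kkt_mat)
  have zW: "z W = block_vec x lam mu"
    using solution_eq_matrix_inv[OF inv] kkt_solves_linear_system[OF assms(1,2)]
    by (metis G_def q_def s_def z_def)
  have z: "(z \<longlongrightarrow> z W) (nhds W)"
    unfolding z_def by (rule tendsto_matrix_inv_mult[OF G inv])
  have primal: "((\<lambda>W'. primal_part (z W')) \<longlongrightarrow> x) (nhds W)"
  proof -
    have "((\<lambda>W'. primal_part (z W')) \<longlongrightarrow> primal_part (z W)) (nhds W)"
      unfolding primal_part_def by (rule vec_tendstoI) (auto intro!: tendsto_intros z)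
    then show ?thesis by (simp add: zW)
  qed
  have ineq: "((\<lambda>W'. ineq_part (z W')) \<longlongrightarrow> mu) (nhds W)"
  proof -
    have "((\<lambda>W'. ineq_part (z W')) \<longlongrightarrow> ineq_part (z W)) (nhds W)"
      unfolding ineq_part_def by (rule vec_tendstoI) (auto intro!: tendsto_intros z)
    then show ?thesis by (simp add: zW)
  qed
  have slack: "((\<lambda>W'. S *v primal_part (z W') + T *v d - u) \<longlongrightarrow> s) (nhds W)"
    unfolding s_def
    by (intro tendsto_intros bounded_linear.tendsto[OF matrix_vector_mul_bounded_linear] primal)
  have "\<forall>\<^sub>F W' in nhds W. \<forall>n. (n \<in> A \<longrightarrow> 0 < ineq_part (z W') $ n)
          \<and> (n \<notin> A \<longrightarrow> (S *v primal_part (z W') + T *v d - u) $ n < 0)"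
  proof (intro eventually_all_finite)
    fix n
    show "\<forall>\<^sub>F W' in nhds W. (n \<in> A \<longrightarrow> 0 < ineq_part (z W') $ n)
          \<and> (n \<notin> A \<longrightarrow> (S *v primal_part (z W') + T *v d - u) $ n < 0)"
      using active[of n] inactive[of n]
        order_tendstoD(1)[OF tendsto_vec_nth[OF ineq, of n], of 0]
        order_tendstoD(2)[OF tendsto_vec_nth[OF slack, of n], of 0]
      by (cases "n \<in> A") auto
  qed
  then have kkt: "\<forall>\<^sub>F W' in nhds W.
      kkt P W' R S T d u (primal_part (z W')) (eq_part (z W')) (ineq_part (z W'))"
    using eventually_invertible[OF G inv]
  proof eventually_elim
    case (elim W')
    have "G W' *v z W' = q"
      using solution_eq_matrix_inv[OF elim(2)] by (simp add: z_def)
    then have "kkt_mat P S mu s W' *v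
        block_vec (primal_part (z W')) (eq_part (z W')) (ineq_part (z W')) = kkt_rhs R T d u mu"
      by (simp add: G_def q_def)
    then show ?case
      by (rule linear_system_solution_kkt[OF assms(1), where A = A])
        (use elim(1) active inactive in force)+
  qed
  then have unique: "\<forall>\<^sub>F W' in nhds W. \<exists>!y. is_qp_minimizer P W' R S T d u y"
    by eventually_elim (simp add: kkt_unique_minimizer[OF assms(1)])
  have min: "\<forall>\<^sub>F W' in nhds W. qp_minimizer P W' R S T d u = primal_part (z W')"
    using kkt by eventually_elim (rule kkt_qp_minimizer[OF assms(1)])
  have "has_partial_deriv (\<lambda>W'. l (qp_minimizer P W' R S T d u))
     ((outer_product lam phi_x + outer_product phi_lam x) $ i $ j) (axis i (axis j 1)) W" for i j
  proof -
    define E :: "real^'n^'m" where "E = axis i (axis j 1)"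
    define dz where "dz = - (matrix_inv (G W) *v (kkt_dir E *v z W))"
    have line: "((\<lambda>t. W + t *\<^sub>R E) \<longlongrightarrow> W) (nhds 0)"
      by (auto intro!: tendsto_eq_intros filterlim_ident)
    have "((\<lambda>t. z (W + t *\<^sub>R E)) has_vector_derivative dz) (at 0)"
      using has_vector_derivative_matrix_inv_mult[OF inv, of "kkt_dir E" q]
      unfolding z_def dz_def G_def kkt_mat_perturb .
    moreover have "bounded_linear (primal_part :: real^('n + ('m + 'm)) \<Rightarrow> real^'n)"
      unfolding linear_conv_bounded_linear[symmetric]
      by (rule linearI) (simp_all add: primal_part_def vec_eq_iff)
    ultimately have "((\<lambda>t. primal_part (z (W + t *\<^sub>R E))) has_vector_derivative primal_part dz) (at 0)"
      by (rule bounded_linear.has_vector_derivative[rotated])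
    moreover have "(l has_derivative (\<lambda>h. gradient l x \<bullet> h)) (at (primal_part (z (W + 0 *\<^sub>R E))))"
      using has_derivative_gradient[OF assms(6)] by (simp add: zW)
    ultimately have "((\<lambda>t. l (primal_part (z (W + t *\<^sub>R E)))) has_real_derivative
        gradient l x \<bullet> primal_part dz) (at 0)"
      using diff_chain_at[of "\<lambda>t. primal_part (z (W + t *\<^sub>R E))" "\<lambda>t. t *\<^sub>R primal_part dz" 0 l
          "\<lambda>h. gradient l x \<bullet> h"]
      by (simp add: has_vector_derivative_def has_field_derivative_def o_def mult_commute_abs)
    moreover have "\<forall>\<^sub>F t in nhds 0. l (qp_minimizer P (W + t *\<^sub>R E) R S T d u)
        = l (primal_part (z (W + t *\<^sub>R E)))"
      using eventually_compose_filterlim[OF min line] by eventually_elim simp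
    ultimately have deriv: "((\<lambda>t. l (qp_minimizer P (W + t *\<^sub>R E) R S T d u)) has_real_derivative
        gradient l x \<bullet> primal_part dz) (at 0)"
      by (subst DERIV_cong_ev[OF refl _ refl])
    \<comment> \<open>Moving \<open>\<Gamma>\<inverse>\<close> to the other side of the inner product turns the gradient into \<open>\<phi>\<close>.\<close>
    have "gradient l x \<bullet> primal_part dz = block_vec (gradient l x) 0 0 \<bullet> dz"
      using inner_block_vec[of "gradient l x" 0 0 "primal_part dz" "eq_part dz" "ineq_part dz"]
      by simp
    also have "\<dots> = block_vec phi_x phi_lam phi_mu \<bullet> (kkt_dir E *v block_vec x lam mu)"
      unfolding assms(7) Gamma dz_def zW by (simp add: dot_lmul_matrix)
    also have "\<dots> = (outer_product lam phi_x + outer_product phi_lam x) $ i $ j"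
      by (simp add: kkt_dir_mult_vec E_def inner_axis_matrix outer_product_def)
    finally show ?thesis
      using deriv unfolding has_partial_deriv_def E_def by simp
  qed
  then show ?thesis
    using inv unique kkt_qp_minimizer[OF assms(1,2)]
    by (simp add: Gamma has_matrix_gradient_def)
qed

end
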